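(* Let $N_n(x)=\sum_{k=1}^{n}\frac1n\binom{n}{k-1}\binom nk x^k$ denote the $n$-th Narayana polynomial, $n\ge1$. Then: (1) The number $-1$ is a simple root of $N_n(x)$ for every positive even integer $n$; for $n$ odd one has $N_n(-1)\neq 0$. (2) All roots of $N_n(x)$ are distinct and nonpositive. (3) For $n\ge 2$, the roots of $N_{n-1}(x)/x$ interlace with the roots of $N_n(x)/x$. Except for the origin, the polynomials $N_{n-1}(x)$ and $N_n(x)$ have no root in common.
   Context: $N_n(x)$ has degree $n$ and vanishes at $0$, so $N_n(x)/x$ is a polynomial of degree $n-1$. The roots of $N_{n-1}(x)/x$ (there are $n-2$ of them) interlace with the roots of $N_n(x)/x$ (there are $n-1$ of them) if every open interval between two consecutive roots of $N_n(x)/x$ contains exactly one root of $N_{n-1}(x)/x$. *)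

theory Defs
  imports Complex_Main "HOL-Computational_Algebra.Polynomial"
begin

definition narayana_poly :: "nat \<Rightarrow> real poly" where
  "narayana_poly n =
     (\<Sum>k=1..n. monom (1 / real n * real (n choose (k - 1)) * real (n choose k)) k)"

(* Polynomial division by X is exact here, see narayana_poly_quot_times_X. *)
definition narayana_quot :: "nat \<Rightarrow> real poly" where
  "narayana_quot n = narayana_poly n div [:0, 1:]"

definition consecutive_roots :: "real poly \<Rightarrow> real \<Rightarrow> real \<Rightarrow> bool" where
  "consecutive_roots p a b \<longleftrightarrow>
     a < b \<and> poly p a = 0 \<and> poly p b = 0 \<and> (\<forall>x. a < x \<and> x < b \<longrightarrow> poly p x \<noteq> 0)"

(* The roots of q interlace with those of p. Intended for real-rooted p and q with simple
   roots and degree p = degree q + 1; these side conditions are not part of the definition. *)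
definition roots_interlace :: "real poly \<Rightarrow> real poly \<Rightarrow> bool" where
  "roots_interlace q p \<longleftrightarrow>
     (\<forall>a b. consecutive_roots p a b \<longrightarrow> (\<exists>!c. a < c \<and> c < b \<and> poly q c = 0))"

lemma narayana_poly_quot_times_X: "narayana_quot n * [:0, 1:] = narayana_poly n"
proof -
  have "[:0, 1:] dvd narayana_poly n"
    unfolding narayana_poly_def
    by (rule dvd_sum) (auto simp: dvd_iff_poly_eq_0 poly_monom)
  then show ?thesis
    unfolding narayana_quot_def by (rule dvd_div_mult_self)
qed

end

theory Submission imports Defs
begin

text \<open>
  Write $q_n = N_n(x)/x$. All the claims come from one three-term recurrence,
  \[ (n+3)\, q_{n+2} = (2n+3)(1+x)\, q_{n+1} - n\,(1-x)^2\, q_n, \]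
  (lemma \<open>narayana_quot_recurrence\<close>). With $t = (1+x)/(1-x)$ and
  $q_n(x) = (1-x)^{n-1} P_n(t)$ it becomes $(n+3) P_{n+2} = (2n+3)\, t\, P_{n+1} - n P_n$, the
  recurrence of a rescaled family of Gegenbauer polynomials. So the theorem is about the
  roots of orthogonal polynomials, moved to the negative half-line by a Moebius transformation, and
  the usual arguments apply to the ratio $r_n = q_{n+1} / ((1-x) q_n) = P_{n+1}/P_n$, which
  satisfies $(n+3)\, r_{n+1} = (2n+3)\, t - n / r_n$.

  \<^item> The map $x \mapsto t$ and the map $r \mapsto -1/r$ preserve the upper half-plane.
    By induction so does each $r_n$; in particular $q_n$ has no root there, and by conjugation
    none off the real line (\<open>Im_narayana_quot_ratio_pos\<close>, \<open>complex_root_narayana_quot\<close>). Since the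
    coefficients of $q_n$ are nonnegative and $q_n(0) = 1$, its roots are negative.
  \<^item> On the real line the same induction shows that $r_n$ has a positive derivative. After
    clearing denominators this is positivity of a Wronskian on all of the reals
    (\<open>narayana_wronskian_pos\<close>). A double root of $q_n$, or a common root of $q_n$ and
    $q_{n+1}$, would make it vanish, and interlacing follows from it by the mean value theorem
    (\<open>unique_root_between_consecutive_roots\<close>).
  \<^item> At $x = -1$ the middle term of the recurrence drops out, so that $q_{n+2}(-1)$ is a nonzero
    multiple of $q_n(-1)$ for $n \ge 1$. As $q_1(-1) = 1$ and $q_2(-1) = 0$, the parity of $n$ decides.
\<close>

section \<open>The three-term recurrence\<close>

lemma narayana_poly_eq_pCons: "narayana_poly n = pCons 0 (narayana_quot n)"
  by (simp flip: narayana_poly_quot_times_X)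

lemma coeff_narayana_quot:
  "coeff (narayana_quot n) i = real (n choose i) * real (n choose Suc i) / real n"
proof -
  have "coeff (narayana_quot n) i = coeff (narayana_poly n) (Suc i)"
    by (simp add: narayana_poly_eq_pCons)
  also have "\<dots> = (\<Sum>k=1..n. if k = Suc i then real (n choose i) * real (n choose Suc i) / real n else 0)"
    unfolding narayana_poly_def coeff_sum coeff_monom by (intro sum.cong) auto
  also have "\<dots> = real (n choose i) * real (n choose Suc i) / real n"
    by (cases "Suc i \<le> n") (auto simp: not_le binomial_eq_0)
  finally show ?thesis .
qed

lemma binomial_ratio_real:
  "real (Suc k) * real (n choose Suc k) = (real n - real k) * real (n choose k)"
proof (cases "k \<le> n")
  case True
  then show ?thesis
    using binomial_absorb_comp[of n k] binomial_absorption[of k n]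
    by (smt (verit, best) of_nat_diff of_nat_mult binomial_absorption)
qed (simp add: binomial_eq_0)

text \<open>
  The recurrence for a single coefficient. Here \<open>a, b, c, d\<close> stand for the binomial coefficients of
  \<open>n\<close> at \<open>k - 3, \<dots>, k\<close>; by Pascal's rule the coefficients for \<open>n + 1\<close> and \<open>n + 2\<close> are products of
  their sums. The hypotheses are the ratios of neighbouring binomials, and \<open>k \<ge> 3\<close> ensures
  that \<open>a\<close> determines the other three.
\<close>

lemma narayana_number_recurrence:
  fixes a b c d n k :: real
  assumes "n > 0" "k \<ge> 3"
    and "(k - 2) * b = (n - k + 3) * a"
    and "(k - 1) * c = (n - k + 2) * b"
    and "k * d = (n - k + 1) * c"
  shows "(n + 3) * ((a + 2*b + c) * (b + 2*c + d) / (n + 2)) =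
    (2*n + 3) * ((b + c) * (c + d) / (n + 1) + (a + b) * (b + c) / (n + 1))
    - (c * d - 2 * (b * c) + a * b)"
proof -
  \<comment> \<open>Scaling \<open>a\<close> by this factor makes all four numbers polynomial multiples of \<open>t\<close>, so that the sums
    below factor and every denominator cancels.\<close>
  define t where "t = a / (k * (k - 1) * (k - 2))"
  define m where "m = n - k + 3"
  have k: "k - 2 \<noteq> 0" "k - 1 \<noteq> 0" "k \<noteq> 0" and n: "n + 1 \<noteq> 0" "n + 2 \<noteq> 0" using assms by auto
  have a: "a = k * (k - 1) * (k - 2) * t" using k by (simp add: t_def)
  have b: "b = m * k * (k - 1) * t"
  proof -
    have "b = m * a / (k - 2)" using assms(3) k by (simp add: m_def field_simps)
    then show ?thesis using k by (simp add: a)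
  qed
  have c: "c = (m - 1) * m * k * t"
  proof -
    have "c = (m - 1) * b / (k - 1)" using assms(4) k by (simp add: m_def field_simps)
    then show ?thesis using k by (simp add: b)
  qed
  have d: "d = (m - 2) * (m - 1) * m * t"
  proof -
    have "d = (m - 2) * c / k" using assms(5) k by (simp add: m_def field_simps)
    then show ?thesis using k by (simp add: c)
  qed
  have n_eq: "n = m + k - 3" by (simp add: m_def)
  have ab: "a + b = (n + 1) * (k * (k - 1) * t)"
    and bc: "b + c = (n + 1) * (m * k * t)"
    and cd: "c + d = (n + 1) * ((m - 1) * m * t)"
    and abc: "a + 2 * b + c = (n + 2) * ((n + 1) * (k * t))"
    and bcd: "b + 2 * c + d = (n + 2) * ((n + 1) * (m * t))"
    by (simp_all add: a b c d n_eq algebra_simps)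
  have "(n + 3) * ((a + 2*b + c) * (b + 2*c + d) / (n + 2)) =
      (n + 3) * (n + 2) * (n + 1)^2 * k * m * t^2"
    using n by (simp add: abc bcd power2_eq_square)
  also have "\<dots> = (2*n + 3) * (n + 1) * m * k * t^2 * ((m - 1) * m + k * (k - 1))
      - (c * d - 2 * (b * c) + a * b)"
    unfolding a b c d n_eq by algebra
  also have "(2*n + 3) * (n + 1) * m * k * t^2 * ((m - 1) * m + k * (k - 1)) =
      (2*n + 3) * ((b + c) * (c + d) / (n + 1) + (a + b) * (b + c) / (n + 1))"
  proof -
    have "(b + c) * (c + d) / (n + 1) = (m * k * t) * ((n + 1) * ((m - 1) * m * t))"
      "(a + b) * (b + c) / (n + 1) = (k * (k - 1) * t) * ((n + 1) * (m * k * t))"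
      using n by (simp_all add: ab bc cd)
    then show ?thesis by algebra
  qed
  finally show ?thesis .
qed

lemma narayana_quot_1: "narayana_quot (Suc 0) = 1"
  by (rule poly_eqI) (auto simp: coeff_narayana_quot coeff_pCons split: nat.split)

lemma narayana_quot_2: "narayana_quot (Suc (Suc 0)) = [:1, 1:]"
  by (rule poly_eqI) (auto simp: coeff_narayana_quot coeff_pCons split: nat.split)

text \<open>
  For \<open>n = 0\<close> the last term has the factor \<open>0\<close>, so this also expresses the second quotient through
  the first. The coefficients of \<open>x\<^sup>0\<close> and \<open>x\<^sup>1\<close> involve fewer than four binomials
  and are compared directly.
\<close>

lemma narayana_quot_recurrence:
  "smult (real n + 3) (narayana_quot (n + 2)) =
     smult (2 * real n + 3) ([:1, 1:] * narayana_quot (n + 1))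
     - smult (real n) ([:1, -2, 1:] * narayana_quot n)"
proof (cases "n = 0")
  case True
  then show ?thesis by (simp add: narayana_quot_1 narayana_quot_2)
next
  case False
  show ?thesis
  proof (rule poly_eqI)
    fix i :: nat
    consider "i = 0" | "i = 1" | j where "i = j + 2"
      by (metis One_nat_def Suc_1 add_2_eq_Suc' not0_implies_Suc)
    then show "coeff (smult (real n + 3) (narayana_quot (n + 2))) i =
       coeff (smult (2 * real n + 3) ([:1, 1:] * narayana_quot (n + 1))
       - smult (real n) ([:1, -2, 1:] * narayana_quot n)) i"
    proof cases
      case 1
      then show ?thesis using False by (simp add: coeff_narayana_quot)
    next
      case 2
      have c1: "coeff (narayana_quot m) (Suc 0) = real m * (real m - 1) / 2" for m
        using binomial_ratio_real[of 1 m] by (simp add: coeff_narayana_quot mult.commute)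
      have c0: "coeff (narayana_quot m) 0 = 1" if "m \<noteq> 0" for m
        using that by (simp add: coeff_narayana_quot)
      show ?thesis using 2 False by (simp add: c0 c1 field_simps)
    next
      case 3
      \<comment> \<open>Coefficient \<open>j + 2\<close> of the quotient is coefficient \<open>j + 3\<close> of the Narayana polynomial,
        hence the choice \<open>k = j + 3\<close> below.\<close>
      define a b c d where "a = real (n choose j)" and "b = real (n choose (j + 1))"
        and "c = real (n choose (j + 2))" and "d = real (n choose (j + 3))"
      note abcd = a_def b_def c_def d_def
      have "coeff (narayana_quot (n + 2)) (j + 2) = (a + 2*b + c) * (b + 2*c + d) / (real n + 2)"
        and "coeff (narayana_quot (n + 1)) (j + 2) = (b + c) * (c + d) / (real n + 1)"
        and "coeff (narayana_quot (n + 1)) (j + 1) = (a + b) * (b + c) / (real n + 1)"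
        and "coeff (narayana_quot n) (j + 2) = c * d / real n"
        and "coeff (narayana_quot n) (j + 1) = b * c / real n"
        and "coeff (narayana_quot n) j = a * b / real n"
        by (simp_all add: coeff_narayana_quot abcd eval_nat_numeral add_ac)
      then have "coeff (smult (real n + 3) (narayana_quot (n + 2))) i =
          (real n + 3) * ((a + 2*b + c) * (b + 2*c + d) / (real n + 2))"
        and "coeff (smult (2 * real n + 3) ([:1, 1:] * narayana_quot (n + 1))
            - smult (real n) ([:1, -2, 1:] * narayana_quot n)) i =
          (2 * real n + 3) * ((b + c) * (c + d) / (real n + 1) + (a + b) * (b + c) / (real n + 1))
            - real n * (c * d / real n - 2 * (b * c / real n) + a * b / real n)"
        by (simp_all add: 3 algebra_simps)
      moreover have "real n * (c * d / real n - 2 * (b * c / real n) + a * b / real n) =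
          c * d - 2 * (b * c) + a * b"
        using False by (simp add: field_simps)
      moreover have "(real n + 3) * ((a + 2*b + c) * (b + 2*c + d) / (real n + 2)) =
          (2 * real n + 3) * ((b + c) * (c + d) / (real n + 1) + (a + b) * (b + c) / (real n + 1))
          - (c * d - 2 * (b * c) + a * b)"
      proof (rule narayana_number_recurrence[where k = "real j + 3"])
        show "(real j + 3 - 2) * b = (real n - (real j + 3) + 3) * a"
          "(real j + 3 - 1) * c = (real n - (real j + 3) + 2) * b"
          "(real j + 3) * d = (real n - (real j + 3) + 1) * c"
          using binomial_ratio_real[of j n] binomial_ratio_real[of "j + 1" n]
            binomial_ratio_real[of "j + 2" n]
          by (simp_all add: abcd eval_nat_numeral add_ac)
      qed (use False in auto)
      ultimately show ?thesis by simp
    qed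
  qed
qed

section \<open>Real polynomials in a larger algebra\<close>

lemma map_poly_of_real_add:
  "map_poly of_real (p + q) = map_poly of_real p + (map_poly of_real q :: 'a::real_algebra_1 poly)"
  by (rule poly_eqI) (simp add: coeff_map_poly)

lemma map_poly_of_real_diff:
  "map_poly of_real (p - q) = map_poly of_real p - (map_poly of_real q :: 'a::{real_algebra_1,ab_group_add} poly)"
  by (rule poly_eqI) (simp add: coeff_map_poly)

lemma pderiv_map_poly_of_real:
  "pderiv (map_poly of_real p) = (map_poly of_real (pderiv p) :: 'a::{real_algebra_1,idom} poly)"
  by (rule poly_eqI) (simp add: coeff_map_poly coeff_pderiv)

lemma poly_map_poly_of_real:
  "poly (map_poly of_real p) (of_real x) = (of_real (poly p x) :: 'a::{real_algebra_1,comm_ring_1})"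
  by (induction p) (simp_all add: map_poly_pCons)

section \<open>Values of the quotients\<close>

text \<open>
  The constant coefficient is \<open>1\<close> and no coefficient is negative.
\<close>

lemma poly_narayana_quot_pos:
  assumes "n \<ge> 1" "x \<ge> 0"
  shows "poly (narayana_quot n) x > 0"
proof -
  have "coeff (narayana_quot n) 0 * x ^ 0
      \<le> (\<Sum>i\<le>degree (narayana_quot n). coeff (narayana_quot n) i * x ^ i)"
    using assms by (intro member_le_sum) (auto simp: coeff_narayana_quot)
  then show ?thesis using assms by (simp add: poly_altdef coeff_narayana_quot)
qed

lemma poly_narayana_quot_recurrence:
  "(real n + 3) * poly (narayana_quot (n + 2)) x =
     (2 * real n + 3) * (1 + x) * poly (narayana_quot (n + 1)) x
     - real n * (1 - x)^2 * poly (narayana_quot n) x"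
proof -
  have "poly (smult (real n + 3) (narayana_quot (n + 2))) x =
    poly (smult (2 * real n + 3) ([:1, 1:] * narayana_quot (n + 1))
     - smult (real n) ([:1, -2, 1:] * narayana_quot n)) x"
    by (simp only: narayana_quot_recurrence)
  then show ?thesis by (simp add: power2_eq_square algebra_simps)
qed

lemma poly_pderiv_narayana_quot_recurrence:
  "(real n + 3) * poly (pderiv (narayana_quot (n + 2))) x =
     (2 * real n + 3) * (poly (narayana_quot (n + 1)) x + (1 + x) * poly (pderiv (narayana_quot (n + 1))) x)
     - real n * ((1 - x)^2 * poly (pderiv (narayana_quot n)) x - 2 * (1 - x) * poly (narayana_quot n) x)"
proof -
  have "poly (pderiv (smult (real n + 3) (narayana_quot (n + 2)))) x =
    poly (pderiv (smult (2 * real n + 3) ([:1, 1:] * narayana_quot (n + 1))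
     - smult (real n) ([:1, -2, 1:] * narayana_quot n))) x"
    by (simp only: narayana_quot_recurrence)
  then show ?thesis
    by (simp add: pderiv_smult pderiv_diff pderiv_add pderiv_pCons power2_eq_square algebra_simps)
qed

lemma poly_complex_narayana_quot_recurrence:
  fixes z :: complex and n :: nat
  defines "Q \<equiv> \<lambda>n. poly (map_poly of_real (narayana_quot n)) z"
  shows "(of_nat n + 3) * Q (n + 2) =
    (2 * of_nat n + 3) * (1 + z) * Q (n + 1) - of_nat n * (1 - z)^2 * Q n"
proof -
  have "poly (map_poly of_real (smult (real n + 3) (narayana_quot (n + 2)))) z =
    poly (map_poly of_real (smult (2 * real n + 3) ([:1, 1:] * narayana_quot (n + 1))
     - smult (real n) ([:1, -2, 1:] * narayana_quot n))) z"
    by (simp only: narayana_quot_recurrence)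
  then have "(of_nat n + 3) * Q (n + 2) =
    (2 * of_nat n + 3) * ((1 + z) * Q (n + 1)) - of_nat n * ((1 - 2 * z + z^2) * Q n)"
    by (simp add: Q_def map_poly_of_real_add map_poly_of_real_diff map_poly_smult map_poly_pCons
        power2_eq_square algebra_simps)
  then show ?thesis by (simp add: power2_eq_square algebra_simps)
qed

section \<open>Positivity of the Wronskian\<close>

text \<open>
  The numerator of the derivative of $q_{n+1} / ((1-x) q_n)$, that is, the Wronskian
  $p' g - p g'$ of $p = q_{n+1}$ and $g = (1-x) q_n$. The plain Wronskian of $q_{n+1}$ and $q_n$
  would not do: its recurrence contains a product of two quotients, which has no definite sign. The
  factor $1-x$ absorbs that term.
\<close>

definition narayana_wronskian :: "nat \<Rightarrow> real \<Rightarrow> real" where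
  "narayana_wronskian n x =
     (1 - x) * (poly (pderiv (narayana_quot (n + 1))) x * poly (narayana_quot n) x
       - poly (narayana_quot (n + 1)) x * poly (pderiv (narayana_quot n)) x)
     + poly (narayana_quot (n + 1)) x * poly (narayana_quot n) x"

lemma narayana_wronskian_recurrence:
  "(real n + 3) * narayana_wronskian (n + 1) x =
     2 * (2 * real n + 3) * (poly (narayana_quot (n + 1)) x)^2
     + real n * (1 - x)^2 * narayana_wronskian n x"
proof -
  let ?q = "\<lambda>k. poly (narayana_quot (n + k)) x"
  let ?d = "\<lambda>k. poly (pderiv (narayana_quot (n + k))) x"
  have "(real n + 3) * narayana_wronskian (n + 1) x =
      (1 - x) * (((real n + 3) * ?d 2) * ?q 1 - ((real n + 3) * ?q 2) * ?d 1)
      + ((real n + 3) * ?q 2) * ?q 1"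
    by (simp add: narayana_wronskian_def algebra_simps)
  also have "\<dots> = 2 * (2 * real n + 3) * (?q 1)^2 + real n * (1 - x)^2 * narayana_wronskian n x"
    unfolding poly_narayana_quot_recurrence poly_pderiv_narayana_quot_recurrence narayana_wronskian_def
    by (simp add: power2_eq_square algebra_simps)
  finally show ?thesis by simp
qed

text \<open>
  Both terms of the recurrence are nonnegative. The second one is positive except at \<open>x = 1\<close>, where
  the first one takes over because the quotients are positive there.
\<close>

lemma narayana_wronskian_pos: "n \<ge> 1 \<Longrightarrow> narayana_wronskian n x > 0"
proof (induction n rule: nat_induct_at_least)
  case base
  show ?case by (simp add: narayana_wronskian_def narayana_quot_1 narayana_quot_2 pderiv_pCons)
next
  case (Suc n)
  have "2 * (2 * real n + 3) * (poly (narayana_quot (n + 1)) x)^2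
     + real n * (1 - x)^2 * narayana_wronskian n x > 0"
  proof (cases "x = 1")
    case True
    then show ?thesis using poly_narayana_quot_pos[of "n + 1" x] by (simp add: zero_less_mult_iff)
  next
    case False
    then show ?thesis using Suc by (intro add_nonneg_pos) auto
  qed
  then have "(real n + 3) * narayana_wronskian (n + 1) x > 0"
    by (simp only: narayana_wronskian_recurrence)
  then show ?case by (simp add: zero_less_mult_iff)
qed

section \<open>Location of the roots\<close>

text \<open>
  The ratio $r_n$ maps the upper half-plane to itself: $r_{n+1}$ is a combination, with
  nonnegative coefficients, of $(1+z)/(1-z)$ and $-1/r_n$, which both have positive
  imaginary part. That $q_{n+1}(z) \ne 0$ follows from the same statement, since otherwise
  $r_n$ would be \<open>0\<close>.
\<close>

lemma Im_narayana_quot_ratio_pos: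
  fixes z :: complex
  defines "Q \<equiv> \<lambda>n. poly (map_poly of_real (narayana_quot n)) z"
  assumes "Im z > 0" "n \<ge> 1"
  shows "Q n \<noteq> 0 \<and> Im (Q (n + 1) / ((1 - z) * Q n)) > 0"
  using \<open>n \<ge> 1\<close>
proof (induction n rule: nat_induct_at_least)
  have z: "1 - z \<noteq> 0" using \<open>Im z > 0\<close> by auto
  have t: "Im ((1 + z) / (1 - z)) > 0"
  proof -
    have "Im ((1 + z) / (1 - z)) = 2 * Im z / ((1 - Re z)^2 + (Im z)^2)"
      by (simp add: Im_divide algebra_simps)
    then show ?thesis using \<open>Im z > 0\<close> by (simp add: sum_power2_gt_zero_iff)
  qed
  {
    case base
    show ?case using t by (simp add: Q_def narayana_quot_1 narayana_quot_2 map_poly_pCons)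
  next
    case (Suc n)
    define r where "r = Q (n + 1) / ((1 - z) * Q n)"
    define s where "s = Q (n + 2) / ((1 - z) * Q (n + 1))"
    define t where "t = (1 + z) / (1 - z)"
    have r: "Im r > 0" and Qn: "Q n \<noteq> 0" using Suc by (auto simp: r_def)
    then have Q1: "Q (n + 1) \<noteq> 0" by (auto simp: r_def)
    have "(of_nat n + 3) * Q (n + 2) =
        (2 * of_nat n + 3) * (1 + z) * Q (n + 1) - of_nat n * (1 - z)^2 * Q n"
      unfolding Q_def by (rule poly_complex_narayana_quot_recurrence)
    then have "(of_nat n + 3) * s = (2 * of_nat n + 3) * t - of_nat n * inverse r"
      using z Qn Q1 by (simp add: r_def s_def t_def field_simps power2_eq_square)
    from arg_cong[OF this, of Im]
    have "(real n + 3) * Im s = (2 * real n + 3) * Im t - real n * Im (inverse r)"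
      by (simp del: inverse_complex.sel)
    moreover have "(2 * real n + 3) * Im t > 0" using t by (simp add: t_def)
    moreover have "Im (inverse r) < 0"
      using r by (simp add: divide_neg_pos sum_power2_gt_zero_iff)
    then have "real n * Im (inverse r) \<le> 0"
      by (intro mult_nonneg_nonpos) (simp_all del: inverse_complex.sel)
    ultimately have "(real n + 3) * Im s > 0" by linarith
    then have "Im s > 0" by (simp add: zero_less_mult_iff)
    then show ?case using Q1 by (simp add: s_def)
  }
qed

text \<open>
  The lower half-plane reduces to the upper one because the coefficients are real.
\<close>

lemma complex_root_narayana_quot:
  fixes z :: complex
  assumes "n \<ge> 1" "poly (map_poly of_real (narayana_quot n)) z = 0"
  obtains x where "z = of_real x" "x < 0" "poly (narayana_quot n) x = 0"
proof -
  let ?p = "map_poly complex_of_real (narayana_quot n)"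
  have "map_poly cnj ?p = ?p" by (rule poly_eqI) (simp add: coeff_map_poly)
  then have "poly ?p (cnj z) = 0"
    using assms(2) poly_cnj[of ?p z] by simp
  then have "\<not> Im z > 0" "\<not> Im (cnj z) > 0"
    using assms Im_narayana_quot_ratio_pos by blast+
  then have z: "z = of_real (Re z)" by (simp add: complex_eq_iff)
  then have root: "poly (narayana_quot n) (Re z) = 0"
    using assms(2) by (metis of_real_eq_0_iff poly_map_poly_of_real)
  then have neg: "Re z < 0" using poly_narayana_quot_pos[OF assms(1), of "Re z"] by fastforce
  show thesis by (rule that[OF z neg root])
qed

lemma narayana_quot_consecutive_no_common_root:
  assumes "n \<ge> 1" "poly (narayana_quot n) x = 0"
  shows "poly (narayana_quot (n + 1)) x \<noteq> 0"
  using narayana_wronskian_pos[OF assms(1), of x] assms(2) by (auto simp: narayana_wronskian_def)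

lemma rsquarefree_narayana_quot:
  assumes "n \<ge> 1"
  shows "rsquarefree (narayana_quot n)"
proof (cases "n = 1")
  case False
  with assms have "n = n - 1 + 1" "n - 1 \<ge> 1" by auto
  then show ?thesis
    using narayana_wronskian_pos[of "n - 1"] unfolding rsquarefree_roots narayana_wronskian_def
    by (metis add_0_right diff_self less_irrefl mult_zero_left mult_zero_right)
qed (simp add: narayana_quot_1 rsquarefree_roots)

text \<open>
  Compared with its quotient, the Narayana polynomial has the additional root \<open>0\<close>; it is simple as
  well, because the roots of the quotient are negative.
\<close>

lemma rsquarefree_complex_narayana_poly:
  assumes "n \<ge> 1"
  shows "rsquarefree (map_poly complex_of_real (narayana_poly n))"
  unfolding rsquarefree_roots
proof (rule allI, rule notI, elim conjE)
  fix z :: complex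
  let ?q = "map_poly complex_of_real (narayana_quot n)"
  assume "poly (map_poly of_real (narayana_poly n)) z = 0"
    and "poly (pderiv (map_poly of_real (narayana_poly n))) z = 0"
  then have "poly ?q z * z = 0" and 2: "poly ?q z + z * poly (pderiv ?q) z = 0"
    by (auto simp: narayana_poly_eq_pCons map_poly_pCons pderiv_pCons)
  then have q: "poly ?q z = 0" by auto
  then obtain x where x: "z = of_real x" "x < 0" "poly (narayana_quot n) x = 0"
    using complex_root_narayana_quot[OF assms] by metis
  have "poly (pderiv ?q) z = 0" using 2 q x by simp
  then have "poly (pderiv (narayana_quot n)) x = 0"
    by (simp add: x pderiv_map_poly_of_real poly_map_poly_of_real)
  then show False using x rsquarefree_narayana_quot[OF assms] by (auto simp: rsquarefree_roots)
qed

lemma rsquarefree_narayana_poly: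
  assumes "n \<ge> 1"
  shows "rsquarefree (narayana_poly n)"
  using rsquarefree_complex_narayana_poly[OF assms]
  unfolding rsquarefree_roots pderiv_map_poly_of_real
  by (metis of_real_0 poly_map_poly_of_real)

lemma poly_narayana_quot_minus_one_eq_0_iff:
  "poly (narayana_quot n) (-1) = 0 \<longleftrightarrow> even n"
proof (induction n rule: induct_nat_012)
  case 0
  show ?case by (simp add: poly_altdef coeff_narayana_quot)
next
  case 1
  show ?case by (simp add: narayana_quot_1)
next
  case (ge2 n)
  have "(real n + 3) * poly (narayana_quot (Suc (Suc n))) (-1) = - 4 * real n * poly (narayana_quot n) (-1)"
    using poly_narayana_quot_recurrence[of n "-1"] by simp
  then have "poly (narayana_quot (Suc (Suc n))) (-1) = 0 \<longleftrightarrow> n = 0 \<or> poly (narayana_quot n) (-1) = 0"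
    by (smt (verit) mult_eq_0_iff of_nat_0_le_iff of_nat_eq_0_iff)
  with ge2 show ?case by auto
qed

section \<open>Interlacing\<close>

text \<open>
  Suppose that the Wronskian $p' g - p g'$ is positive. If \<open>g\<close> had no root between the roots
  \<open>a\<close> and \<open>b\<close> of \<open>p\<close>, the quotient $p/g$ would vanish at both ends although its
  derivative is positive. If \<open>g\<close> had two roots there, the same contradiction would arise for
  $g/p$, whose derivative is negative and whose denominator has no zero between \<open>a\<close> and \<open>b\<close>.
\<close>

lemma unique_root_between_consecutive_roots:
  fixes p g :: "real poly"
  assumes roots: "consecutive_roots p a b"
    and wronskian: "\<And>x. a \<le> x \<Longrightarrow> x \<le> b \<Longrightarrow>
      poly (pderiv p) x * poly g x - poly p x * poly (pderiv g) x > 0"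
  shows "\<exists>!c. a < c \<and> c < b \<and> poly g c = 0"
proof -
  from roots have ab: "a < b" and pa: "poly p a = 0" and pb: "poly p b = 0"
    and ne: "\<And>x. a < x \<Longrightarrow> x < b \<Longrightarrow> poly p x \<noteq> 0"
    unfolding consecutive_roots_def by auto
  have wa: "poly (pderiv p) a * poly g a > 0" and wb: "poly (pderiv p) b * poly g b > 0"
    using wronskian[of a] wronskian[of b] ab pa pb by auto
  have "\<exists>c. a < c \<and> c < b \<and> poly g c = 0"
  proof (rule ccontr)
    assume "\<not> ?thesis"
    moreover have "poly g a \<noteq> 0" "poly g b \<noteq> 0" using wa wb by auto
    ultimately have g: "poly g x \<noteq> 0" if "a \<le> x" "x \<le> b" for x
      using that by (metis less_eq_real_def)
    have "\<exists>z. a < z \<and> z < b \<and> (poly p b / poly g b - poly p a / poly g a) = (b - a) *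
      ((poly (pderiv p) z * poly g z - poly p z * poly (pderiv g) z) / (poly g z * poly g z))"
      using ab g by (intro MVT2) (auto intro!: derivative_eq_intros)
    then obtain z where "a < z" "z < b"
      "poly (pderiv p) z * poly g z - poly p z * poly (pderiv g) z = 0"
      using ab pa pb g by force
    then show False using wronskian[of z] by simp
  qed
  moreover have False if cd: "a < c" "c < d" "d < b" "poly g c = 0" "poly g d = 0" for c d
  proof -
    have "\<exists>z. c < z \<and> z < d \<and> (poly g d / poly p d - poly g c / poly p c) = (d - c) *
      ((poly (pderiv g) z * poly p z - poly g z * poly (pderiv p) z) / (poly p z * poly p z))"
      using cd ne by (intro MVT2) (auto intro!: derivative_eq_intros)
    then obtain z where z: "c < z" "z < d"
      "poly (pderiv g) z * poly p z - poly g z * poly (pderiv p) z = 0"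
      using cd ne by force
    then show False using wronskian[of z] cd by (simp add: algebra_simps)
  qed
  ultimately show ?thesis by (metis linorder_neqE_linordered_idom)
qed

text \<open>
  Positivity of the Wronskian gives the claim for $(1-x) q_n$ in place of $q_n$. The extra root
  \<open>1\<close> is harmless since all roots of $q_{n+1}$ are negative.
\<close>

lemma narayana_quot_roots_interlace:
  assumes "n \<ge> 1"
  shows "roots_interlace (narayana_quot n) (narayana_quot (n + 1))"
  unfolding roots_interlace_def
proof (intro allI impI)
  fix a b
  assume ab: "consecutive_roots (narayana_quot (n + 1)) a b"
  then have "b < 0"
    using poly_narayana_quot_pos[of "n + 1" b] by (fastforce simp: consecutive_roots_def)
  have "\<exists>!c. a < c \<and> c < b \<and> poly ([:1, -1:] * narayana_quot n) c = 0"
  proof (rule unique_root_between_consecutive_roots[OF ab])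
    fix x
    show "0 < poly (pderiv (narayana_quot (n + 1))) x * poly ([:1, - 1:] * narayana_quot n) x
      - poly (narayana_quot (n + 1)) x * poly (pderiv ([:1, - 1:] * narayana_quot n)) x"
      using narayana_wronskian_pos[OF assms, of x] unfolding narayana_wronskian_def pderiv_mult
      by (simp add: pderiv_pCons algebra_simps)
  qed
  moreover have "poly ([:1, -1:] * narayana_quot n) c = 0 \<longleftrightarrow> poly (narayana_quot n) c = 0" if "c < b" for c
    using that \<open>b < 0\<close> by (auto simp: algebra_simps simp flip: left_diff_distrib)
  ultimately show "\<exists>!c. a < c \<and> c < b \<and> poly (narayana_quot n) c = 0" by metis
qed

section \<open>Roots of the Narayana polynomials\<close>

lemma poly_complex_narayana_poly:
  "poly (map_poly complex_of_real (narayana_poly n)) z = z * poly (map_poly of_real (narayana_quot n)) z"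
  by (simp add: narayana_poly_eq_pCons map_poly_pCons)

theorem theorem7:
  shows "(\<forall>n\<ge>1. (even n \<longrightarrow> order (-1) (narayana_poly n) = 1) \<and>
                 (odd n \<longrightarrow> poly (narayana_poly n) (-1) \<noteq> 0)) \<and>
         (\<forall>n\<ge>1. \<forall>z::complex. poly (map_poly of_real (narayana_poly n)) z = 0 \<longrightarrow>
                 z \<in> \<real> \<and> Re z \<le> 0 \<and> order z (map_poly of_real (narayana_poly n)) = 1) \<and>
         (\<forall>n\<ge>2. roots_interlace (narayana_quot (n - 1)) (narayana_quot n) \<and>
                 (\<forall>z::complex. poly (map_poly of_real (narayana_poly (n - 1))) z = 0 \<and>
                               poly (map_poly of_real (narayana_poly n)) z = 0 \<longleftrightarrow> z = 0))"
proof (intro conjI allI impI)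
  have root_iff: "poly (narayana_poly n) (-1) = 0 \<longleftrightarrow> even n" for n
    by (simp add: poly_narayana_quot_minus_one_eq_0_iff narayana_poly_eq_pCons)
  fix n :: nat
  assume n: "n \<ge> 1"
  show "order (-1) (narayana_poly n) = 1" if "even n"
    using rsquarefree_root_order[OF rsquarefree_narayana_poly[OF n]] rsquarefree_narayana_poly[OF n]
      that root_iff by (auto simp: rsquarefree_def)
  show "poly (narayana_poly n) (-1) \<noteq> 0" if "odd n"
    using that root_iff by simp
next
  fix n :: nat and z :: complex
  assume n: "n \<ge> 1" and z: "poly (map_poly of_real (narayana_poly n)) z = 0"
  have "z = 0 \<or> poly (map_poly of_real (narayana_quot n)) z = 0"
    using z by (simp add: poly_complex_narayana_poly)
  then obtain x where "z = of_real x" "x \<le> 0"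
    using complex_root_narayana_quot[OF n] by (metis less_imp_le of_real_0 order_refl)
  then show "z \<in> \<real>" "Re z \<le> 0" by auto
  show "order z (map_poly of_real (narayana_poly n)) = 1"
    using rsquarefree_complex_narayana_poly[OF n] z
    by (intro rsquarefree_root_order) (auto simp: rsquarefree_def)
next
  fix n :: nat
  assume n: "n \<ge> 2"
  then have n': "n - 1 \<ge> 1" "n - 1 + 1 = n" by auto
  show "roots_interlace (narayana_quot (n - 1)) (narayana_quot n)"
    using narayana_quot_roots_interlace[OF n'(1)] n'(2) by simp
  fix z :: complex
  show "poly (map_poly of_real (narayana_poly (n - 1))) z = 0 \<and>
        poly (map_poly of_real (narayana_poly n)) z = 0 \<longleftrightarrow> z = 0"
  proof
    assume *: "poly (map_poly of_real (narayana_poly (n - 1))) z = 0 \<and>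
      poly (map_poly of_real (narayana_poly n)) z = 0"
    show "z = 0"
    proof (rule ccontr)
      assume "z \<noteq> 0"
      with * have 1: "poly (map_poly of_real (narayana_quot (n - 1))) z = 0"
        and 2: "poly (map_poly of_real (narayana_quot n)) z = 0"
        by (auto simp: poly_complex_narayana_poly)
      from 1 obtain x where x: "z = of_real x" "poly (narayana_quot (n - 1)) x = 0"
        by (rule complex_root_narayana_quot[OF n'(1)])
      with 2 have "poly (narayana_quot n) x = 0" by (simp add: poly_map_poly_of_real)
      then show False
        using narayana_quot_consecutive_no_common_root[OF n'(1) x(2)] n'(2) by simp
    qed
  qed (simp add: poly_complex_narayana_poly)
qed

end
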